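(* Let $d\ge1$ and $m\ge0$ be integers. Then $$\inf_{L\in\mathcal L}\sup_D\mathfrak R_m(L,D)\ \ge\ \inf_{L\in\mathcal L_{\mathsf{rand}}}\sup_D\mathfrak R_m(L,D)\ \ge\ B_0(m,d):=\sup_{b\in[0,1]}b\,\mathsf E\operatorname{bayes}(N,b),$$ where $\sup_D$ is over all probability distributions $D$ on $[d]\times\{-1,1\}$ and $N$ is a binomial random variable with parameters $m$ and $1/d$.
   Context: Setting: $\mathcal X=[d]=\{1,\dots,d\}$, $\mathcal Y=\{-1,1\}$, $\mathcal H=\mathcal Y^{\mathcal X}$. For a probability distribution $D$ on $\mathcal X\times\mathcal Y$, $(X^D,Y^D)$ is a random pair with distribution $D$, and $Z_m^D$ is the sequence of $m$ independent copies of it. Put $\operatorname{err}(h,D)=\mathsf P(h(X^D)\ne Y^D)$ and $\Delta(h,D)=\operatorname{err}(h,D)-\min_{g\in\mathcal H}\operatorname{err}(g,D)$. $\mathcal L$ is the set of all (non-randomized) learning algorithms, i.e. maps $L\colon(\mathcal X\times\mathcal Y)^m\to\mathcal H$; $\mathcal L_{\mathsf{rand}}$ is the set of all randomized learning algorithms, i.e. maps $L\colon(\mathcal X\times\mathcal Y)^m\times[-1,1]\to\mathcal H$ (measurable in the last argument). The expected excess risk is $\mathfrak R_m(L,D):=\mathsf E\,\Delta(L(Z_m^D),D)$ for $L\in\mathcal L$ and $\mathfrak R_m(L,D):=\mathsf E\,\Delta(L(Z_m^D,U),D)$ for $L\in\mathcal L_{\mathsf{rand}}$, with $U$ uniform on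 $[-1,1]$ and independent of $Z_m^D$. For $k\in\{0,1,\dots\}$ and $b\in[-1,1]$: $V^b_k:=Y^b_1+\dots+Y^b_k$, where the $Y^b_i$ are iid with $\mathsf P(Y^b_i=1)=\frac{1+b}2$, $\mathsf P(Y^b_i=-1)=\frac{1-b}2$ (so $V^b_0=0$); $s_k(b):=|\mathsf P(V^b_k>0)-\mathsf P(V^{-b}_k>0)|$; $\operatorname{bayes}(k,b):=\frac12\big(1-s_k(b)\big)$. *)

theory Defs
  imports "HOL-Probability.Probability"
begin

text \<open>
  The domain is \<open>{1..d}\<close>, the labels are the integers \<open>-1\<close> and \<open>1\<close>. All function spaces
  are extensional (\<open>\<rightarrow>\<^sub>E\<close>), so that their elements are exactly the maps between the given
  finite or interval carriers.
\<close>

definition labels :: "int set" where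
  "labels = {-1, 1}"

definition hypotheses :: "nat \<Rightarrow> (nat \<Rightarrow> int) set" where
  "hypotheses d = {1..d} \<rightarrow>\<^sub>E labels"

definition distrs :: "nat \<Rightarrow> (nat \<times> int) pmf set" where
  "distrs d = {D. set_pmf D \<subseteq> {1..d} \<times> labels}"

definition sample_seqs :: "nat \<Rightarrow> nat \<Rightarrow> (nat \<times> int) list set" where
  "sample_seqs d m = {zs. set zs \<subseteq> {1..d} \<times> labels \<and> length zs = m}"

definition err :: "(nat \<Rightarrow> int) \<Rightarrow> (nat \<times> int) pmf \<Rightarrow> real" where
  "err h D = measure_pmf.prob D {(x, y). h x \<noteq> y}"

definition excess :: "nat \<Rightarrow> (nat \<Rightarrow> int) \<Rightarrow> (nat \<times> int) pmf \<Rightarrow> real" where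
  "excess d h D = err h D - (MIN g\<in>hypotheses d. err g D)"

definition learners :: "nat \<Rightarrow> nat \<Rightarrow> ((nat \<times> int) list \<Rightarrow> nat \<Rightarrow> int) set" where
  "learners d m = sample_seqs d m \<rightarrow>\<^sub>E hypotheses d"

definition rand_learners :: "nat \<Rightarrow> nat \<Rightarrow> ((nat \<times> int) list \<times> real \<Rightarrow> nat \<Rightarrow> int) set" where
  "rand_learners d m =
     {L \<in> (sample_seqs d m \<times> {-1..1}) \<rightarrow>\<^sub>E hypotheses d.
        \<forall>zs\<in>sample_seqs d m.
          (\<lambda>u. L (zs, u)) \<in> measurable (restrict_space borel {-1..1}) (count_space (hypotheses d))}"

text \<open>
  \<open>replicate_pmf m D\<close> is the law of a sequence of \<open>m\<close> independent draws from \<open>D\<close>; the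
  independence of the sample and the randomizer is expressed by the product measure.
\<close>

definition risk :: "nat \<Rightarrow> nat \<Rightarrow> ((nat \<times> int) list \<Rightarrow> nat \<Rightarrow> int) \<Rightarrow> (nat \<times> int) pmf \<Rightarrow> real" where
  "risk d m L D = measure_pmf.expectation (replicate_pmf m D) (\<lambda>zs. excess d (L zs) D)"

definition rand_risk ::
    "nat \<Rightarrow> nat \<Rightarrow> ((nat \<times> int) list \<times> real \<Rightarrow> nat \<Rightarrow> int) \<Rightarrow> (nat \<times> int) pmf \<Rightarrow> real" where
  "rand_risk d m L D =
     (\<integral>zu. excess d (L zu) D
        \<partial>(measure_pmf (replicate_pmf m D) \<Otimes>\<^sub>M uniform_measure lborel {-1..1}))"

text \<open>
  The parameter \<open>b\<close> below is meant to lie in \<open>[-1, 1]\<close>; outside this range \<open>bernoulli_pmf\<close>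
  clamps its argument.
\<close>

definition sign_pmf :: "real \<Rightarrow> int pmf" where
  "sign_pmf b = map_pmf (\<lambda>c. if c then 1 else -1) (bernoulli_pmf ((1 + b) / 2))"

definition V_pmf :: "nat \<Rightarrow> real \<Rightarrow> int pmf" where
  "V_pmf k b = map_pmf sum_list (replicate_pmf k (sign_pmf b))"

definition s_fun :: "nat \<Rightarrow> real \<Rightarrow> real" where
  "s_fun k b = \<bar>measure_pmf.prob (V_pmf k b) {v. v > 0} - measure_pmf.prob (V_pmf k (-b)) {v. v > 0}\<bar>"

definition bayes :: "nat \<Rightarrow> real \<Rightarrow> real" where
  "bayes k b = (1 - s_fun k b) / 2"

definition B0 :: "nat \<Rightarrow> nat \<Rightarrow> real" where
  "B0 m d =
     (SUP b\<in>{0..1}. b * measure_pmf.expectation (binomial_pmf m (1 / real d)) (\<lambda>n. bayes n b))"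

end

theory Submission
  imports Defs
begin

text \<open>
  Given \<open>b\<close>, take \<open>X\<close> uniform on \<open>{1..d}\<close> and the label at \<open>x\<close> with mean \<open>b * \<theta> x\<close> for a label
  vector \<open>\<theta>\<close>. The excess risk is then \<open>b / d\<close> times the expected number of wrong values of the
  learner. Average over all \<open>\<theta>\<close> and, for each point \<open>x\<close>, pair \<open>\<theta>\<close> with its flip at \<open>x\<close>: deciding
  between the two is a binary testing problem, for which by Neyman and Pearson the sign of the sum
  of the labels observed at \<open>x\<close> is optimal. This sum is a sum of \<open>N\<close> signs of bias \<open>\<plusminus>b\<close> with \<open>N\<close>
  binomial, which produces the factor \<open>bayes N b\<close>. A randomized learner is a mixture of
  deterministic ones, so the averaged bound carries over, and some \<open>\<theta>\<close> does at least as badly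
  as the average.
\<close>

section \<open>Events and likelihoods of discrete distributions\<close>

lemma prob_bind_pmf:
  fixes p :: "'a pmf" and f :: "'a \<Rightarrow> 'b pmf"
  shows "measure_pmf.prob (bind_pmf p f) A = measure_pmf.expectation p (\<lambda>x. measure_pmf.prob (f x) A)"
proof -
  \<comment> \<open>An event becomes the single point \<open>True\<close> under the membership test,
    so \<open>pmf_bind\<close> applies to it.\<close>
  have eq: "measure_pmf.prob q A = pmf (map_pmf (\<lambda>x. x \<in> A) q) True" for q :: "'b pmf"
    by (simp add: pmf_map vimage_def)
  show ?thesis
    by (simp only: eq map_bind_pmf pmf_bind)
qed

lemma prob_compl_pmf: "measure_pmf.prob p (- A) = 1 - measure_pmf.prob p A"
  using measure_pmf.prob_compl[of A p] by (simp flip: Compl_eq_Diff_UNIV)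

lemma prob_mono_pmf:
  assumes "\<And>z. z \<in> S \<Longrightarrow> pmf p z \<le> pmf q z"
  shows "measure_pmf.prob p S \<le> measure_pmf.prob q S"
proof -
  have "emeasure (measure_pmf p) S \<le> emeasure (measure_pmf q) S"
    unfolding nn_integral_pmf[symmetric] using assms
    by (intro nn_integral_mono) (auto intro: ennreal_leI)
  then show ?thesis
    by (simp add: measure_pmf.emeasure_eq_measure)
qed

text \<open>Passing from \<open>B\<close> to \<open>W\<close> drops only points where
  \<open>q\<close> dominates and adds only points where \<open>p\<close> dominates, so the
  difference of probabilities cannot decrease. Ties may lie on either side.\<close>

lemma neyman_pearson_pmf:
  assumes "\<And>z. z \<in> W \<Longrightarrow> pmf q z \<le> pmf p z"
    and "\<And>z. z \<notin> W \<Longrightarrow> pmf p z \<le> pmf q z"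
  shows "measure_pmf.prob p B - measure_pmf.prob q B
           \<le> measure_pmf.prob p W - measure_pmf.prob q W"
proof -
  have split: "measure_pmf.prob r S = measure_pmf.prob r (S \<inter> T) + measure_pmf.prob r (S - T)"
    for r :: "'a pmf" and S T
    using measure_pmf.finite_measure_Union[of "S \<inter> T" r "S - T"] by (simp add: Int_Diff_Un Int_Diff_disjoint)
  have "measure_pmf.prob p (B - W) \<le> measure_pmf.prob q (B - W)"
    "measure_pmf.prob q (W - B) \<le> measure_pmf.prob p (W - B)"
    by (rule prob_mono_pmf, use assms in auto)+
  then show ?thesis
    using split[of p B W] split[of q B W] split[of p W B] split[of q W B]
    by (simp add: Int_commute)
qed

lemma pmf_replicate_Suc:
  "pmf (replicate_pmf (Suc n) p) (z # zs) = pmf p z * pmf (replicate_pmf n p) zs"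
proof -
  have "replicate_pmf (Suc n) p = map_pmf (\<lambda>(x, xs). x # xs) (pair_pmf p (replicate_pmf n p))"
    by (simp add: pair_pmf_def map_bind_pmf)
  moreover have "inj (\<lambda>(x, xs). x # xs)"
    by (auto simp: inj_on_def)
  ultimately show ?thesis
    using pmf_map_inj'[of "\<lambda>(x, xs). x # xs" "pair_pmf p (replicate_pmf n p)" "(z, zs)"]
    by (simp add: pmf_pair)
qed

section \<open>Noisy labelings and their excess risk\<close>

lemma pmf_sign:
  assumes "-1 \<le> b" "b \<le> 1" "y \<in> labels"
  shows "pmf (sign_pmf b) y = (1 + b * of_int y) / 2"
proof -
  let ?g = "\<lambda>c. if c then 1 else - 1 :: int" and ?B = "bernoulli_pmf ((1 + b) / 2)"
  have "inj ?g"
    by (auto simp: inj_on_def split: if_splits)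
  note inj = pmf_map_inj'[OF this, of ?B]
  have "pmf (sign_pmf b) 1 = (1 + b) / 2" "pmf (sign_pmf b) (-1) = 1 - (1 + b) / 2"
    using inj[of True] inj[of False] assms(1,2) by (simp_all add: sign_pmf_def)
  then show ?thesis
    using assms(3) by (auto simp: labels_def field_simps)
qed

lemma set_pmf_sign: "set_pmf (sign_pmf b) \<subseteq> labels"
  unfolding sign_pmf_def labels_def set_map_pmf by (intro image_subsetI) simp

definition noisy_pmf :: "nat \<Rightarrow> real \<Rightarrow> (nat \<Rightarrow> int) \<Rightarrow> (nat \<times> int) pmf" where
  "noisy_pmf d b \<theta> =
     bind_pmf (pmf_of_set {1..d}) (\<lambda>x. map_pmf (Pair x) (sign_pmf (b * of_int (\<theta> x))))"

lemma hypothesesD: "\<theta> \<in> hypotheses d \<Longrightarrow> x \<in> {1..d} \<Longrightarrow> \<theta> x \<in> labels"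
  by (auto simp: hypotheses_def)

lemma finite_hypotheses: "finite (hypotheses d)"
  by (simp add: hypotheses_def labels_def finite_PiE)

lemma hypotheses_nonempty: "hypotheses d \<noteq> {}"
  by (simp add: hypotheses_def labels_def PiE_eq_empty_iff)

lemma set_pmf_noisy:
  assumes "d \<ge> 1"
  shows "set_pmf (noisy_pmf d b \<theta>) \<subseteq> {1..d} \<times> labels"
  using set_pmf_sign assms by (auto simp: noisy_pmf_def)

lemma pmf_noisy:
  assumes "x \<in> {1..d}"
  shows "pmf (noisy_pmf d b \<theta>) (x, y) = pmf (sign_pmf (b * of_int (\<theta> x))) y / d"
proof -
  have "pmf (map_pmf (Pair x') (sign_pmf c)) (x, y) = (if x' = x then pmf (sign_pmf c) y else 0)" for x' c
  proof -
    have "Pair x' -` {(x, y)} = (if x' = x then {y} else {})"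
      by auto
    then show ?thesis
      by (simp add: pmf_map measure_pmf_single)
  qed
  then show ?thesis
    using assms by (simp add: noisy_pmf_def pmf_bind integral_pmf_of_set)
qed

text \<open>A right guess errs with probability (1 - b) / 2 and a wrong one with (1 + b) / 2; the
  gap \<open>b\<close> is the price of one mistake.\<close>

lemma prob_sign_neq:
  assumes "0 \<le> b" "b \<le> 1" "t \<in> labels" "s \<in> labels"
  shows "measure_pmf.prob (sign_pmf (b * of_int t)) {y. s \<noteq> y} = (1 - b) / 2 + (if s \<noteq> t then b else 0)"
proof -
  have "measure_pmf.prob (sign_pmf (b * of_int t)) {y. s \<noteq> y} = 1 - pmf (sign_pmf (b * of_int t)) s"
  proof -
    have "{y. s \<noteq> y} = - {s}"
      by auto
    then show ?thesis
      by (simp only: prob_compl_pmf measure_pmf_single)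
  qed
  also have "\<dots> = (1 - b) / 2 + (if s \<noteq> t then b else 0)"
    using assms by (auto simp: pmf_sign labels_def field_simps)
  finally show ?thesis .
qed

lemma err_noisy:
  assumes "d \<ge> 1" "0 \<le> b" "b \<le> 1" "\<theta> \<in> hypotheses d" "h \<in> hypotheses d"
  shows "err h (noisy_pmf d b \<theta>) = (1 - b) / 2 + b / d * (\<Sum>x=1..d. of_bool (h x \<noteq> \<theta> x))"
proof -
  have "err h (noisy_pmf d b \<theta>)
      = (\<Sum>x=1..d. measure_pmf.prob (sign_pmf (b * of_int (\<theta> x))) {y. h x \<noteq> y}) / d"
    using assms(1) by (simp add: err_def noisy_pmf_def prob_bind_pmf integral_pmf_of_set vimage_def)
  also have "\<dots> = (\<Sum>x=1..d. (1 - b) / 2 + b * of_bool (h x \<noteq> \<theta> x)) / d"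
    using assms by (auto intro!: sum.cong arg_cong[where f="\<lambda>t. t / real d"] simp: prob_sign_neq hypothesesD)
  also have "\<dots> = (1 - b) / 2 + b / d * (\<Sum>x=1..d. of_bool (h x \<noteq> \<theta> x))"
    using assms(1) by (simp add: sum.distrib add_divide_distrib flip: sum_distrib_left)
  finally show ?thesis .
qed

text \<open>The hypothesis \<theta> itself attains the minimal error: it makes no mistakes and keeps
  only the noise level (1 - b) / 2.\<close>

lemma excess_noisy:
  assumes "d \<ge> 1" "0 \<le> b" "b \<le> 1" "\<theta> \<in> hypotheses d" "h \<in> hypotheses d"
  shows "excess d h (noisy_pmf d b \<theta>) = b / d * (\<Sum>x=1..d. of_bool (h x \<noteq> \<theta> x))"
proof -
  have "(MIN g\<in>hypotheses d. err g (noisy_pmf d b \<theta>)) = (1 - b) / 2"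
  proof (rule Min_eqI)
    show "(1 - b) / 2 \<in> (\<lambda>g. err g (noisy_pmf d b \<theta>)) ` hypotheses d"
      by (rule image_eqI[of _ _ \<theta>]) (use assms in \<open>auto simp: err_noisy\<close>)
    fix e assume "e \<in> (\<lambda>g. err g (noisy_pmf d b \<theta>)) ` hypotheses d"
    then obtain g where g: "g \<in> hypotheses d" "e = err g (noisy_pmf d b \<theta>)"
      by blast
    have "0 \<le> b / d * (\<Sum>x=1..d. of_bool (g x \<noteq> \<theta> x))"
      using assms by (intro mult_nonneg_nonneg sum_nonneg) auto
    then show "(1 - b) / 2 \<le> e"
      unfolding g(2) err_noisy[OF assms(1-4) g(1)] by linarith
  qed (simp add: finite_hypotheses)
  then show ?thesis
    using assms by (simp add: excess_def err_noisy)
qed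

section \<open>Labels observed at one point: law of their sum and likelihoods\<close>

text \<open>The test statistic. Draws at other points count as 0 instead of being filtered out, so
  that under \<open>replicate_pmf\<close> it is a sum of iid terms.\<close>

definition label_sum :: "nat \<Rightarrow> (nat \<times> int) list \<Rightarrow> int" where
  "label_sum x zs = (\<Sum>(x', y)\<leftarrow>zs. if x' = x then y else 0)"

text \<open>A uniform point hits \<open>x\<close> with probability 1 / d, and only a hit reveals a
  biased sign.\<close>

lemma map_pmf_noisy_label:
  assumes "x \<in> {1..d}"
  shows "map_pmf (\<lambda>(x', y). if x' = x then y else 0) (noisy_pmf d b \<theta>)
    = bind_pmf (bernoulli_pmf (1 / d)) (\<lambda>c. if c then sign_pmf (b * of_int (\<theta> x)) else return_pmf 0)"
proof -
  have bern: "map_pmf (\<lambda>x'. x' = x) (pmf_of_set {1..d}) = bernoulli_pmf (1 / d)"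
  proof (rule pmf_eqI)
    fix c
    have "measure_pmf.prob (pmf_of_set {1..d}) {x} = 1 / d"
      using assms by (simp add: measure_pmf_single)
    moreover note prob_compl_pmf[of "pmf_of_set {1..d}" "{x}"]
    moreover have "(\<lambda>x'. x' = x) -` {True} = {x}" "(\<lambda>x'. x' = x) -` {False} = - {x}"
      by auto
    ultimately show "pmf (map_pmf (\<lambda>x'. x' = x) (pmf_of_set {1..d})) c = pmf (bernoulli_pmf (1 / d)) c"
      using assms by (cases c) (simp_all add: pmf_map)
  qed
  show ?thesis
    unfolding bern[symmetric] noisy_pmf_def map_bind_pmf bind_map_pmf pmf.map_comp
    by (intro bind_pmf_cong) (auto simp: o_def)
qed

lemma V_pmf_0: "V_pmf 0 b = return_pmf 0"
  by (simp add: V_pmf_def)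

lemma V_pmf_Suc: "V_pmf (Suc k) b = bind_pmf (sign_pmf b) (\<lambda>y. map_pmf ((+) y) (V_pmf k b))"
  by (simp add: V_pmf_def map_bind_pmf pmf.map_comp o_def map_pmf_def bind_assoc_pmf bind_return_pmf)

text \<open>The number of hits of \<open>x\<close> is binomial, and given this number the labels
  seen are iid signs. In the induction one more draw adds either 0 or a fresh sign, which matches
  the recursions of \<open>binomial_pmf\<close> and \<open>V_pmf\<close>.\<close>

lemma map_pmf_label_sum:
  assumes "x \<in> {1..d}"
  shows "map_pmf (label_sum x) (replicate_pmf m (noisy_pmf d b \<theta>))
    = bind_pmf (binomial_pmf m (1 / d)) (\<lambda>k. V_pmf k (b * of_int (\<theta> x)))"
proof (induction m)
  case 0
  then show ?case
    using assms by (simp add: label_sum_def binomial_pmf_0 bind_return_pmf V_pmf_0)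
next
  case (Suc m)
  let ?D = "noisy_pmf d b \<theta>" and ?c = "b * of_int (\<theta> x)"
  let ?g = "\<lambda>(x', y). if x' = x then y else 0"
  let ?R = "replicate_pmf m ?D"
  have "map_pmf (label_sum x) (replicate_pmf (Suc m) ?D)
      = bind_pmf ?D (\<lambda>z. map_pmf (\<lambda>zs. ?g z + label_sum x zs) ?R)"
    by (simp add: map_bind_pmf map_pmf_def bind_assoc_pmf bind_return_pmf label_sum_def)
  also have "\<dots> = bind_pmf (map_pmf ?g ?D) (\<lambda>y. map_pmf ((+) y) (map_pmf (label_sum x) ?R))"
    by (simp add: bind_map_pmf pmf.map_comp o_def)
  also have "\<dots> = bind_pmf (bernoulli_pmf (1 / d)) (\<lambda>c. bind_pmf (binomial_pmf m (1 / d))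
      (\<lambda>k. V_pmf ((if c then 1 else 0) + k) ?c))"
    unfolding map_pmf_noisy_label[OF assms] Suc.IH bind_assoc_pmf map_bind_pmf
  proof (intro bind_pmf_cong refl)
    \<comment> \<open>On a hit, the fresh sign and the count of the other hits are independent and
      can be drawn in either order; on a miss, 0 is added.\<close>
    fix c
    have "(+) (0::int) = id"
      by auto
    then
    show "bind_pmf (if c then sign_pmf ?c else return_pmf 0)
        (\<lambda>y. bind_pmf (binomial_pmf m (1 / d)) (\<lambda>k. map_pmf ((+) y) (V_pmf k ?c)))
      = bind_pmf (binomial_pmf m (1 / d)) (\<lambda>k. V_pmf ((if c then 1 else 0) + k) ?c)"
      by (cases c)
        (simp_all add: V_pmf_Suc bind_return_pmf bind_commute_pmf[of "sign_pmf ?c"] pmf.map_id)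
  qed
  also have "\<dots> = bind_pmf (binomial_pmf (Suc m) (1 / d)) (\<lambda>k. V_pmf k ?c)"
    using assms by (simp add: binomial_pmf_Suc bind_assoc_pmf bind_return_pmf)
  finally show ?case .
qed

text \<open>The likelihood ratio of a label vector and its flip at a point depends only on the labels
  observed there: \<open>a\<close> of them are \<open>1\<close> and \<open>c\<close> are \<open>-1\<close>.\<close>

lemma noisy_likelihood:
  assumes "0 \<le> b" "b \<le> 1" "\<theta> x = 1" "x \<in> {1..d}" "zs \<in> sample_seqs d m"
  obtains C :: real and a c :: nat where
    "C \<ge> 0" "label_sum x zs = int a - int c"
    "pmf (replicate_pmf m (noisy_pmf d b \<theta>)) zs = C * (1 + b) ^ a * (1 - b) ^ c"
    "pmf (replicate_pmf m (noisy_pmf d b (\<theta>(x := -1)))) zs = C * (1 - b) ^ a * (1 + b) ^ c"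
proof -
  let ?P = "\<lambda>m zs C a c. 0 \<le> (C::real) \<and> label_sum x zs = int a - int c \<and>
    pmf (replicate_pmf m (noisy_pmf d b \<theta>)) zs = C * (1 + b) ^ a * (1 - b) ^ c \<and>
    pmf (replicate_pmf m (noisy_pmf d b (\<theta>(x := -1)))) zs = C * (1 - b) ^ a * (1 + b) ^ c"
  have "\<exists>C a c. ?P m zs C a c"
    using assms(5)
  proof (induction m arbitrary: zs)
    case 0
    then show ?case
      by (intro exI[of _ 1] exI[of _ 0]) (auto simp: sample_seqs_def label_sum_def)
  next
    case (Suc m)
    then obtain x' y ws where zs: "zs = (x', y) # ws" "ws \<in> sample_seqs d m"
      and x': "x' \<in> {1..d}" and y: "y \<in> labels"
      by (auto simp: sample_seqs_def length_Suc_conv)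
    obtain C a c where IH: "?P m ws C a c"
      using Suc.IH[OF zs(2)] by blast
    have d: "d \<ge> 1"
      using assms(4) by auto
    show ?case
    proof (cases "x' = x")
      case True
      consider "y = 1" | "y = -1"
        using y by (auto simp: labels_def)
      then show ?thesis
      proof cases
        case 1
        \<comment> \<open>This draw has mass (1 + b) / (2 d) under \<theta> and (1 - b) / (2 d)
          under its flip; the common 1 / (2 d) goes into the constant.\<close>
        have "?P (Suc m) zs (C / (2 * d)) (Suc a) c"
          unfolding zs(1) pmf_replicate_Suc
          using IH True 1 assms x' y by (auto simp: pmf_noisy pmf_sign label_sum_def field_simps)
        then show ?thesis by blast
      next
        case 2
        have "?P (Suc m) zs (C / (2 * d)) a (Suc c)"
          unfolding zs(1) pmf_replicate_Suc
          using IH True 2 assms x' y by (auto simp: pmf_noisy pmf_sign label_sum_def field_simps)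
        then show ?thesis by blast
      qed
    next
      case False
      \<comment> \<open>Away from \<open>x\<close> the two label vectors agree, so the whole factor
        is common.\<close>
      have "?P (Suc m) zs (pmf (noisy_pmf d b \<theta>) (x', y) * C) a c"
        unfolding zs(1) pmf_replicate_Suc
        using IH False x' by (auto simp: pmf_noisy label_sum_def)
      then show ?thesis by blast
    qed
  qed
  then show thesis
    using that by blast
qed

text \<open>After cancelling \<open>c\<close> powers of each factor, it remains that 1 - b \<le> 1 +
  b. The product form, in place of a ratio, includes b = 1.\<close>

lemma power_swap_le:
  fixes b C :: real
  assumes "0 \<le> b" "b \<le> 1" "0 \<le> C" "c \<le> a"
  shows "C * (1 - b) ^ a * (1 + b) ^ c \<le> C * (1 + b) ^ a * (1 - b) ^ c"
proof -
  obtain e where a: "a = c + e"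
    using assms(4) le_Suc_ex by blast
  have "(1 - b) ^ e \<le> (1 + b) ^ e"
    using assms by (intro power_mono) auto
  then have "C * (1 - b) ^ c * (1 + b) ^ c * (1 - b) ^ e \<le> C * (1 - b) ^ c * (1 + b) ^ c * (1 + b) ^ e"
    using assms by (intro mult_left_mono) auto
  then show ?thesis
    by (simp add: a power_add algebra_simps)
qed

text \<open>The likelihood comparison ranges over all lists; those that are not samples have mass 0
  on both sides.\<close>

lemma pmf_replicate_outside:
  assumes "set_pmf D \<subseteq> {1..d} \<times> labels" "zs \<notin> sample_seqs d m"
  shows "pmf (replicate_pmf m D) zs = 0"
proof -
  have "zs \<notin> set_pmf (replicate_pmf m D)"
    using assms by (auto simp: set_replicate_pmf sample_seqs_def)
  then show ?thesis
    by (simp add: set_pmf_iff)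
qed

section \<open>Testing a label vector against its flip\<close>

text \<open>The two error probabilities of a test add up to at least 1 minus the difference of its
  probabilities of answering 1. That difference is largest for the sign of \<open>label_sum\<close>,
  where it is the mean over the number of hits of a quantity bounded by
  \<open>s_fun\<close>.\<close>

lemma noisy_flip_pair:
  fixes h :: "(nat \<times> int) list \<Rightarrow> int"
  assumes "0 \<le> b" "b \<le> 1" "\<theta> x = 1" "x \<in> {1..d}"
  shows "measure_pmf.prob (replicate_pmf m (noisy_pmf d b \<theta>)) {zs. h zs \<noteq> 1}
      + measure_pmf.prob (replicate_pmf m (noisy_pmf d b (\<theta>(x := -1)))) {zs. h zs \<noteq> -1}
      \<ge> 2 * measure_pmf.expectation (binomial_pmf m (1 / d)) (\<lambda>n. bayes n b)"
proof -
  let ?p = "replicate_pmf m (noisy_pmf d b \<theta>)"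
  let ?q = "replicate_pmf m (noisy_pmf d b (\<theta>(x := -1)))"
  let ?N = "binomial_pmf m (1 / d)"
  let ?W = "{zs. label_sum x zs > 0}"
  let ?v = "\<lambda>b k. measure_pmf.prob (V_pmf k b) {v. v > 0}"
  have d: "d \<ge> 1"
    using assms by auto
  \<comment> \<open>A zero sum means a = c and hence equal masses, so assigning ties to the label -1
    is harmless.\<close>
  have order: "(label_sum x zs > 0 \<longrightarrow> pmf ?q zs \<le> pmf ?p zs) \<and>
      (\<not> label_sum x zs > 0 \<longrightarrow> pmf ?p zs \<le> pmf ?q zs)" for zs
  proof (cases "zs \<in> sample_seqs d m")
    case True
    obtain C a c where *: "C \<ge> 0" "label_sum x zs = int a - int c"
      "pmf ?p zs = C * (1 + b) ^ a * (1 - b) ^ c" "pmf ?q zs = C * (1 - b) ^ a * (1 + b) ^ c"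
      using noisy_likelihood[where \<theta>=\<theta> and x=x, OF assms True] by blast
    show ?thesis
      using power_swap_le[OF assms(1,2) *(1), of c a] power_swap_le[OF assms(1,2) *(1), of a c]
      by (auto simp: * algebra_simps)
  next
    case False
    then show ?thesis
      using pmf_replicate_outside[OF set_pmf_noisy[OF d]] by simp
  qed
  have W: "measure_pmf.prob (replicate_pmf m (noisy_pmf d b \<eta>)) ?W
      = measure_pmf.expectation ?N (?v (b * of_int (\<eta> x)))" for \<eta>
  proof -
    have "measure_pmf.prob (replicate_pmf m (noisy_pmf d b \<eta>)) ?W
        = measure_pmf.prob (map_pmf (label_sum x) (replicate_pmf m (noisy_pmf d b \<eta>))) {v. v > 0}"
      by (simp add: vimage_def)
    then show ?thesis
      by (simp add: map_pmf_label_sum[OF assms(4)] prob_bind_pmf)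
  qed
  have int: "integrable (measure_pmf ?N) (f :: nat \<Rightarrow> real)" for f
    using d by (intro integrable_measure_pmf_finite) (simp add: set_pmf_binomial_eq)
  have "measure_pmf.prob ?p {zs. h zs = 1} - measure_pmf.prob ?q {zs. h zs = 1}
      \<le> measure_pmf.prob ?p ?W - measure_pmf.prob ?q ?W"
    by (rule neyman_pearson_pmf) (use order in auto)
  also have "\<dots> = measure_pmf.expectation ?N (\<lambda>k. ?v b k - ?v (- b) k)"
    using assms by (simp add: W int)
  also have "\<dots> \<le> measure_pmf.expectation ?N (\<lambda>k. s_fun k b)"
    by (intro integral_mono int) (simp add: s_fun_def)
  also have "\<dots> = 1 - 2 * measure_pmf.expectation ?N (\<lambda>n. bayes n b)"
    by (simp add: bayes_def int field_simps)
  finally have 1: "measure_pmf.prob ?p {zs. h zs = 1} - measure_pmf.prob ?q {zs. h zs = 1}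
      \<le> 1 - 2 * measure_pmf.expectation ?N (\<lambda>n. bayes n b)" .
  have "{zs. h zs \<noteq> 1} = - {zs. h zs = 1}"
    by auto
  then have 2: "measure_pmf.prob ?p {zs. h zs \<noteq> 1} = 1 - measure_pmf.prob ?p {zs. h zs = 1}"
    by (simp only: prob_compl_pmf)
  \<comment> \<open>Only an inclusion of events, since \<open>h\<close> may take any integer
    value.\<close>
  have 3: "measure_pmf.prob ?q {zs. h zs \<noteq> -1} \<ge> measure_pmf.prob ?q {zs. h zs = 1}"
    by (intro measure_pmf.finite_measure_mono) auto
  show ?thesis
    using 1 2 3 by linarith
qed

section \<open>Averaging over all label vectors\<close>

text \<open>Unlike the update to -1 in the test, this is an involution and hence permutes the label
  vectors.\<close>

definition flip :: "nat \<Rightarrow> (nat \<Rightarrow> int) \<Rightarrow> nat \<Rightarrow> int" where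
  "flip x \<theta> = \<theta>(x := - \<theta> x)"

lemma flip_in_hypotheses:
  assumes "x \<in> {1..d}" "\<theta> \<in> hypotheses d"
  shows "flip x \<theta> \<in> hypotheses d"
proof -
  have "flip x \<theta> i \<in> labels" if "i \<in> {1..d}" for i
    using hypothesesD[OF assms(2) that] by (auto simp: flip_def labels_def)
  moreover have "flip x \<theta> i = undefined" if "i \<notin> {1..d}" for i
    using assms that by (auto simp: flip_def hypotheses_def PiE_iff extensional_def)
  ultimately show ?thesis
    unfolding hypotheses_def by (intro PiE_I)
qed

lemma bij_betw_flip:
  assumes "x \<in> {1..d}"
  shows "bij_betw (flip x) (hypotheses d) (hypotheses d)"
proof (rule bij_betw_byWitness[of _ "flip x"])
  show "flip x ` hypotheses d \<subseteq> hypotheses d" "flip x ` hypotheses d \<subseteq> hypotheses d"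
    using flip_in_hypotheses[OF assms] by blast+
qed (simp_all add: flip_def)

text \<open>Reindexing by \<open>flip x\<close> leaves the sum unchanged, so twice the sum is a sum
  over pairs, each bounded by the test.\<close>

lemma sum_prob_wrong_ge:
  fixes h :: "(nat \<times> int) list \<Rightarrow> int"
  assumes "0 \<le> b" "b \<le> 1" "x \<in> {1..d}"
  shows "(\<Sum>\<theta>\<in>hypotheses d. measure_pmf.prob (replicate_pmf m (noisy_pmf d b \<theta>)) {zs. h zs \<noteq> \<theta> x})
    \<ge> card (hypotheses d) * measure_pmf.expectation (binomial_pmf m (1 / d)) (\<lambda>n. bayes n b)"
proof -
  let ?f = "\<lambda>\<theta>. measure_pmf.prob (replicate_pmf m (noisy_pmf d b \<theta>)) {zs. h zs \<noteq> \<theta> x}"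
  let ?e = "measure_pmf.expectation (binomial_pmf m (1 / d)) (\<lambda>n. bayes n b)"
  have pair: "?f \<theta> + ?f (flip x \<theta>) \<ge> 2 * ?e" if \<theta>: "\<theta> \<in> hypotheses d" for \<theta>
  proof -
    consider "\<theta> x = 1" | "\<theta> x = -1"
      using hypothesesD[OF \<theta> assms(3)] by (auto simp: labels_def)
    then show ?thesis
    proof cases
      case 1
      then show ?thesis
        using noisy_flip_pair[OF assms(1,2), of \<theta> x d m h] assms(3) by (simp add: flip_def)
    next
      \<comment> \<open>Here the flip carries the label 1, so the two vectors exchange roles in the
        test.\<close>
      case 2
      then have "(flip x \<theta>) x = 1" "(flip x \<theta>)(x := -1) = \<theta>"
        by (auto simp: flip_def)
      then show ?thesis
        using noisy_flip_pair[OF assms(1,2), of "flip x \<theta>" x d m h] assms(3) 2 by simp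
    qed
  qed
  have "2 * (card (hypotheses d) * ?e) = (\<Sum>\<theta>\<in>hypotheses d. 2 * ?e)"
    by simp
  also have "\<dots> \<le> (\<Sum>\<theta>\<in>hypotheses d. ?f \<theta> + ?f (flip x \<theta>))"
    by (intro sum_mono pair)
  also have "\<dots> = 2 * (\<Sum>\<theta>\<in>hypotheses d. ?f \<theta>)"
    by (simp only: sum.distrib sum.reindex_bij_betw[OF bij_betw_flip[OF assms(3)], of ?f])
  finally show ?thesis by simp
qed

lemma AE_replicate_pmf_sample:
  assumes "D \<in> distrs d"
  shows "AE zs in measure_pmf (replicate_pmf m D). zs \<in> sample_seqs d m"
  using assms by (auto simp: AE_measure_pmf_iff set_replicate_pmf sample_seqs_def distrs_def)

lemma noisy_in_distrs: "d \<ge> 1 \<Longrightarrow> noisy_pmf d b \<theta> \<in> distrs d"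
  using set_pmf_noisy by (auto simp: distrs_def)

text \<open>The risk splits over the points; after exchanging sums each of the \<open>d\<close>
  points obeys the same bound, which cancels the factor 1 / d. Asking for valid values on samples
  only lets the bound apply to a randomized learner with \<open>u\<close> fixed.\<close>

lemma sum_risk_noisy_ge:
  assumes "d \<ge> 1" "0 \<le> b" "b \<le> 1" "\<And>zs. zs \<in> sample_seqs d m \<Longrightarrow> L zs \<in> hypotheses d"
  shows "(\<Sum>\<theta>\<in>hypotheses d. risk d m L (noisy_pmf d b \<theta>))
    \<ge> card (hypotheses d) * (b * measure_pmf.expectation (binomial_pmf m (1 / d)) (\<lambda>n. bayes n b))"
proof -
  let ?e = "measure_pmf.expectation (binomial_pmf m (1 / d)) (\<lambda>n. bayes n b)"
  let ?p = "\<lambda>\<theta>. replicate_pmf m (noisy_pmf d b \<theta>)"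
  have risk: "risk d m L (noisy_pmf d b \<theta>)
      = b / d * (\<Sum>x=1..d. measure_pmf.prob (?p \<theta>) {zs. L zs x \<noteq> \<theta> x})"
    if "\<theta> \<in> hypotheses d" for \<theta>
  proof -
    have ind: "of_bool (L zs x \<noteq> \<theta> x) = indicat_real {zs. L zs x \<noteq> \<theta> x} zs" for zs x
      by (auto simp: indicator_def)
    \<comment> \<open>The values of \<open>L\<close> are guaranteed to be hypotheses only on
      samples, that is almost surely.\<close>
    have "risk d m L (noisy_pmf d b \<theta>)
        = measure_pmf.expectation (?p \<theta>) (\<lambda>zs. b / d * (\<Sum>x=1..d. of_bool (L zs x \<noteq> \<theta> x)))"
      unfolding risk_def
      by (intro integral_cong_AE eventually_mono[OF AE_replicate_pmf_sample[OF noisy_in_distrs[OF assms(1)]]]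
          excess_noisy assms that) simp_all
    also have "\<dots> = b / d * (\<Sum>x=1..d. measure_pmf.prob (?p \<theta>) {zs. L zs x \<noteq> \<theta> x})"
      unfolding ind by (subst integral_mult_right_zero, subst Bochner_Integration.integral_sum)
        (auto intro!: measure_pmf.integrable_const_bound[where B=1])
    finally show ?thesis .
  qed
  have "card (hypotheses d) * (b * ?e) = b / d * (\<Sum>x=1..d. card (hypotheses d) * ?e)"
    using assms(1) by simp
  also have "\<dots> \<le> b / d * (\<Sum>x=1..d. \<Sum>\<theta>\<in>hypotheses d. measure_pmf.prob (?p \<theta>) {zs. L zs x \<noteq> \<theta> x})"
    using assms by (intro mult_left_mono sum_mono sum_prob_wrong_ge) auto
  also have "\<dots> = (\<Sum>\<theta>\<in>hypotheses d. b / d * (\<Sum>x=1..d. measure_pmf.prob (?p \<theta>) {zs. L zs x \<noteq> \<theta> x}))"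
    by (subst sum.swap) (rule sum_distrib_left)
  also have "\<dots> = (\<Sum>\<theta>\<in>hypotheses d. risk d m L (noisy_pmf d b \<theta>))"
    by (intro sum.cong refl risk[symmetric])
  finally show ?thesis .
qed

section \<open>Randomized learners as mixtures of deterministic ones\<close>

lemma abs_excess_le: "\<bar>excess d h D\<bar> \<le> 1"
proof -
  have "(MIN g\<in>hypotheses d. err g D) \<in> (\<lambda>g. err g D) ` hypotheses d"
    by (intro Min_in) (auto simp: finite_hypotheses hypotheses_nonempty)
  then obtain g where "(MIN g\<in>hypotheses d. err g D) = err g D"
    by blast
  moreover have "0 \<le> err f D \<and> err f D \<le> 1" for f
    by (simp add: err_def)
  from this[of g] this[of h] have "\<bar>err h D - err g D\<bar> \<le> 1"
    by linarith
  ultimately show ?thesis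
    by (simp add: excess_def)
qed

abbreviation unif :: "real measure" where
  "unif \<equiv> uniform_measure lborel {-1..1}"

lemma prob_space_unif: "prob_space unif"
  by (intro prob_space_uniform_measure) auto

lemma AE_unif: "AE u in unif. u \<in> {-1..1}"
  by (intro AE_uniform_measureI) auto

text \<open>There are only countably many lists, so measurability in \<open>u\<close> for each list
  suffices. Outside its domain \<open>L\<close> is constantly \<open>undefined\<close>, so each
  section extends measurably from [-1, 1] to the real line.\<close>

lemma measurable_excess_rand:
  assumes "L \<in> rand_learners d m"
  shows "(\<lambda>zu. excess d (L zu) D) \<in> borel_measurable (measure_pmf p \<Otimes>\<^sub>M unif)"
proof -
  have "L \<in> extensional (sample_seqs d m \<times> {-1..1})"
    using assms by (simp add: rand_learners_def PiE_iff)
  then have outside: "L (zs, u) = undefined"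
    if "zs \<notin> sample_seqs d m \<or> u \<notin> {-1..1}" for zs u
    using that by (intro extensional_arb) auto
  have "(\<lambda>u. excess d (L (zs, u)) D) \<in> borel_measurable borel" for zs
  proof (cases "zs \<in> sample_seqs d m")
    case True
    then have "(\<lambda>u. L (zs, u)) \<in> measurable (restrict_space borel {-1..1}) (count_space (hypotheses d))"
      using assms by (auto simp: rand_learners_def)
    from measurable_compose[OF this, of "\<lambda>h. excess d h D" borel]
    have 1: "(\<lambda>u. excess d (L (zs, u)) D) \<in> borel_measurable (restrict_space borel {-1..1})"
      by simp
    have "(\<lambda>u. if u \<in> {-1..1} then excess d (L (zs, u)) D else excess d undefined D) \<in> borel_measurable borel"
    proof (subst measurable_If_restrict_space_iff)
      have "{x. x \<in> {-1..1}} = {-1..1::real}"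
        by (rule Collect_mem_eq)
      with 1 show "(\<lambda>u. excess d (L (zs, u)) D) \<in> borel_measurable (restrict_space borel {x. x \<in> {-1..1}}) \<and>
          (\<lambda>u. excess d undefined D) \<in> borel_measurable (restrict_space borel {x. x \<notin> {-1..1::real}})"
        by (simp only:) simp
    qed auto
    moreover have "(\<lambda>u. if u \<in> {-1..1} then excess d (L (zs, u)) D else excess d undefined D)
        = (\<lambda>u. excess d (L (zs, u)) D)"
      using outside by auto
    ultimately show ?thesis by simp
  next
    case False
    then show ?thesis
      using outside by simp
  qed
  then have "(\<lambda>zu. excess d (L zu) D) \<in> borel_measurable (count_space UNIV \<Otimes>\<^sub>M unif)"
    by (intro measurable_pair_measure_countable1) (simp_all add: uniform_measure_def)
  moreover have "sets (measure_pmf p \<Otimes>\<^sub>M unif) = sets (count_space UNIV \<Otimes>\<^sub>M unif)"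
    by (intro sets_pair_measure_cong) auto
  ultimately show ?thesis
    using measurable_cong_sets[OF _ refl] by blast
qed

text \<open>Fubini, with integrability from the bounded excess: fixing the randomizer first leaves a
  deterministic learner.\<close>

lemma rand_risk_eq:
  assumes "L \<in> rand_learners d m"
  shows "rand_risk d m L D = (\<integral>u. risk d m (\<lambda>zs. L (zs, u)) D \<partial>unif)"
    and "integrable unif (\<lambda>u. risk d m (\<lambda>zs. L (zs, u)) D)"
proof -
  let ?p = "measure_pmf (replicate_pmf m D)"
  interpret U: prob_space unif
    by (rule prob_space_unif)
  interpret P: pair_prob_space ?p unif ..
  have "integrable (?p \<Otimes>\<^sub>M unif) (\<lambda>zu. excess d (L zu) D)"
    by (rule P.integrable_const_bound[where B=1])
      (auto simp: abs_excess_le intro: measurable_excess_rand assms)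
  then have int: "integrable (?p \<Otimes>\<^sub>M unif) (case_prod (\<lambda>zs u. excess d (L (zs, u)) D))"
    by (simp add: case_prod_beta')
  show "rand_risk d m L D = (\<integral>u. risk d m (\<lambda>zs. L (zs, u)) D \<partial>unif)"
    using P.integral_snd[OF int] by (simp add: rand_risk_def risk_def case_prod_beta')
  show "integrable unif (\<lambda>u. risk d m (\<lambda>zs. L (zs, u)) D)"
    using P.integrable_snd[OF int] by (simp add: risk_def)
qed

lemma abs_risk_le: "\<bar>risk d m L D\<bar> \<le> 1"
proof -
  have "\<bar>risk d m L D\<bar> \<le> measure_pmf.expectation (replicate_pmf m D) (\<lambda>zs. \<bar>excess d (L zs) D\<bar>)"
    unfolding risk_def by (rule integral_abs_bound)
  also have "\<dots> \<le> 1"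
    by (intro measure_pmf.integral_le_const measure_pmf.integrable_const_bound[where B=1])
      (auto simp: abs_excess_le)
  finally show ?thesis .
qed

lemma abs_rand_risk_le:
  assumes "L \<in> rand_learners d m"
  shows "\<bar>rand_risk d m L D\<bar> \<le> 1"
proof -
  interpret U: prob_space unif
    by (rule prob_space_unif)
  have "\<bar>rand_risk d m L D\<bar> \<le> (\<integral>u. \<bar>risk d m (\<lambda>zs. L (zs, u)) D\<bar> \<partial>unif)"
    unfolding rand_risk_eq[OF assms] by (rule integral_abs_bound)
  also have "\<dots> \<le> 1"
    by (intro U.integral_le_const integrable_abs rand_risk_eq assms) (auto simp: abs_risk_le)
  finally show ?thesis .
qed

text \<open>The deterministic bound holds for every \<open>u\<close> in [-1, 1] and survives
  averaging over \<open>u\<close>, as \<open>unif\<close> is a probability measure.\<close>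

lemma sum_rand_risk_noisy_ge:
  assumes "d \<ge> 1" "0 \<le> b" "b \<le> 1" "L \<in> rand_learners d m"
  shows "(\<Sum>\<theta>\<in>hypotheses d. rand_risk d m L (noisy_pmf d b \<theta>))
    \<ge> card (hypotheses d) * (b * measure_pmf.expectation (binomial_pmf m (1 / d)) (\<lambda>n. bayes n b))"
proof -
  interpret U: prob_space unif
    by (rule prob_space_unif)
  have L: "L (zs, u) \<in> hypotheses d" if "zs \<in> sample_seqs d m" "u \<in> {-1..1}" for zs u
    using assms(4) that by (auto simp: rand_learners_def)
  have "card (hypotheses d) * (b * measure_pmf.expectation (binomial_pmf m (1 / d)) (\<lambda>n. bayes n b))
      \<le> (\<integral>u. (\<Sum>\<theta>\<in>hypotheses d. risk d m (\<lambda>zs. L (zs, u)) (noisy_pmf d b \<theta>)) \<partial>unif)"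
    by (intro U.integral_ge_const Bochner_Integration.integrable_sum rand_risk_eq
        eventually_mono[OF AE_unif] sum_risk_noisy_ge assms L)
  also have "\<dots> = (\<Sum>\<theta>\<in>hypotheses d. rand_risk d m L (noisy_pmf d b \<theta>))"
    by (simp add: rand_risk_eq[OF assms(4)])
  finally show ?thesis .
qed

text \<open>The randomizer is ignored. \<open>restrict\<close> makes the map extensional and changes
  it only off the domain, which is a null event.\<close>

lemma learner_as_rand:
  assumes "L \<in> learners d m" "D \<in> distrs d"
  defines "R \<equiv> restrict (\<lambda>(zs, u). L zs) (sample_seqs d m \<times> {-1..1})"
  shows "R \<in> rand_learners d m" and "rand_risk d m R D = risk d m L D"
proof -
  interpret U: prob_space unif
    by (rule prob_space_unif)
  have "(\<lambda>u. R (zs, u)) \<in> measurable (restrict_space borel {-1..1}) (count_space (hypotheses d))"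
    if "zs \<in> sample_seqs d m" for zs
  proof (subst measurable_cong)
    show "R (zs, u) = L zs" if "u \<in> space (restrict_space borel {-1..1})" for u
      using that \<open>zs \<in> sample_seqs d m\<close> by (simp add: R_def space_restrict_space)
    show "(\<lambda>u. L zs) \<in> measurable (restrict_space borel {-1..1}) (count_space (hypotheses d))"
      using assms(1) that by (intro measurable_const) (auto simp: learners_def)
  qed
  then show R: "R \<in> rand_learners d m"
    using assms(1) by (auto simp: rand_learners_def R_def learners_def)
  have "rand_risk d m R D = (\<integral>u. risk d m L D \<partial>unif)"
    unfolding rand_risk_eq[OF R]
  proof (rule integral_cong_AE)
    show "AE u in unif. risk d m (\<lambda>zs. R (zs, u)) D = risk d m L D"
      using AE_unif
    proof (rule eventually_mono)
      fix u :: real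
      assume "u \<in> {-1..1}"
      then show "risk d m (\<lambda>zs. R (zs, u)) D = risk d m L D"
        unfolding risk_def
        by (intro integral_cong_AE eventually_mono[OF AE_replicate_pmf_sample[OF assms(2)]])
          (simp_all add: R_def)
    qed
  qed (auto intro: borel_measurable_integrable rand_risk_eq R)
  then show "rand_risk d m R D = risk d m L D"
    by (simp add: U.prob_space)
qed

section \<open>Comparison of the minimax risks\<close>

theorem theorem2p5:
  fixes d m :: nat
  assumes "d \<ge> 1"
  shows "(INF L\<in>learners d m. SUP D\<in>distrs d. risk d m L D)
           \<ge> (INF L\<in>rand_learners d m. SUP D\<in>distrs d. rand_risk d m L D)
       \<and> (INF L\<in>rand_learners d m. SUP D\<in>distrs d. rand_risk d m L D) \<ge> B0 m d"
proof
  have ne: "distrs d \<noteq> {}"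
    using noisy_in_distrs[OF assms] by blast
  \<comment> \<open>Suprema and infima of reals obey the order rules only for bounded nonempty sets;
    the bounds come from risks lying in [-1, 1].\<close>
  have bdd: "bdd_above (rand_risk d m L ` distrs d)" if "L \<in> rand_learners d m" for L
    using abs_rand_risk_le[OF that] by (intro bdd_aboveI2[of _ _ 1]) (simp add: abs_le_iff)
  have learners_ne: "learners d m \<noteq> {}"
    using hypotheses_nonempty by (auto simp: learners_def PiE_eq_empty_iff)
  have bdd_below: "bdd_below ((\<lambda>L. SUP D\<in>distrs d. rand_risk d m L D) ` rand_learners d m)"
  proof (rule bdd_belowI2)
    fix L assume L: "L \<in> rand_learners d m"
    obtain D where D: "D \<in> distrs d"
      using ne by blast
    have "-1 \<le> rand_risk d m L D"
      using abs_rand_risk_le[OF L, of D] by linarith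
    also have "\<dots> \<le> (SUP D\<in>distrs d. rand_risk d m L D)"
      by (intro cSUP_upper D bdd L)
    finally show "-1 \<le> (SUP D\<in>distrs d. rand_risk d m L D)" .
  qed
  show "(INF L\<in>rand_learners d m. SUP D\<in>distrs d. rand_risk d m L D)
      \<le> (INF L\<in>learners d m. SUP D\<in>distrs d. risk d m L D)"
  proof (rule cINF_greatest[OF learners_ne])
    fix L assume L: "L \<in> learners d m"
    let ?R = "restrict (\<lambda>(zs, u). L zs) (sample_seqs d m \<times> {-1..1})"
    have R: "?R \<in> rand_learners d m"
      using learner_as_rand(1)[OF L] ne by blast
    have "(SUP D\<in>distrs d. rand_risk d m ?R D) = (SUP D\<in>distrs d. risk d m L D)"
      by (intro SUP_cong refl learner_as_rand(2) L)
    then show "(INF L\<in>rand_learners d m. SUP D\<in>distrs d. rand_risk d m L D)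
        \<le> (SUP D\<in>distrs d. risk d m L D)"
      using cINF_lower[OF bdd_below R] by simp
  qed
  have rand_ne: "rand_learners d m \<noteq> {}"
    using learners_ne learner_as_rand(1) ne by blast
  show "B0 m d \<le> (INF L\<in>rand_learners d m. SUP D\<in>distrs d. rand_risk d m L D)"
  proof (rule cINF_greatest[OF rand_ne])
    fix L assume L: "L \<in> rand_learners d m"
    show "B0 m d \<le> (SUP D\<in>distrs d. rand_risk d m L D)"
      unfolding B0_def
    proof (rule cSUP_least)
      fix b :: real assume b: "b \<in> {0..1}"
      let ?v = "b * measure_pmf.expectation (binomial_pmf m (1 / d)) (\<lambda>n. bayes n b)"
      let ?S = "SUP D\<in>distrs d. rand_risk d m L D"
      \<comment> \<open>The supremum \<open>?S\<close> dominates each noisy risk, hence their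
        average over all label vectors, which is at least \<open>?v\<close>.\<close>
      have "card (hypotheses d) * ?v \<le> (\<Sum>\<theta>\<in>hypotheses d. rand_risk d m L (noisy_pmf d b \<theta>))"
        using sum_rand_risk_noisy_ge[OF assms _ _ L] b by simp
      also have "\<dots> \<le> (\<Sum>\<theta>\<in>hypotheses d. ?S)"
        by (intro sum_mono cSUP_upper bdd L noisy_in_distrs assms)
      also have "\<dots> = card (hypotheses d) * ?S"
        by simp
      finally show "?v \<le> ?S"
        using finite_hypotheses hypotheses_nonempty
        by (simp add: mult_le_cancel_left_pos card_gt_0_iff)
    qed simp
  qed
qed

end
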